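(* Let $N\ge1$. Let $a:\mathbb{R}^N\times\mathbb{R}^N\to\mathbb{R}$ be uniformly continuous and $H\in C(\mathbb{R}^N\times\mathbb{R}^N\times\mathbb{R}^N)$. Assume: (1) there is $a_0>0$ with $a_0\le a(x,y)\le a_0^{-1}$ for all $x,y\in\mathbb{R}^N$; (2) $|H(\cdot,\cdot,0)|_\infty<+\infty$, $|a|_\infty<+\infty$, and $a(x,\cdot)$, $H(x,\cdot,p)$ are $\mathbb{Z}^N$-periodic for all $x,p\in\mathbb{R}^N$; (3) there exist $b_0,C_0>0$, $m>1$ such that $\mu H(x,y,\mu^{-1}p)-H(x,y,p)\ge(1-\mu)(b_0|p|^m-C_0)$ for all $\mu\in(0,1)$ and all $x,y,p\in\mathbb{R}^N$; (4) there is a modulus of continuity $\omega$ such that for all $R>0$, all $x,x',y,y'\in\mathbb{R}^N$ and all $p,p'\in\mathbb{R}^N$ with $|p|,|p'|\le R$, $$|H(x,y,p)-H(x',y',p')|\le\omega(|x-x'|+|y-y'|)(1+R^m)+\omega(|p-p'|)(1+R^{m-1}).$$ Then for all $x,p\in\mathbb{R}^N$, $l\in\mathbb{R}$ there exists a unique constant $c=\bar H(x,p,l)$ such that the cell problem $$-a(x,y)l+H(x,y,p+D\psi(y))=c,\qquad y\in\mathbb{T}^N,$$ has a Lipschitz continuous viscosity solution $\psi$.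
   Context: A modulus of continuity is a nondecreasing function $\omega:[0,\infty)\to[0,\infty)$ with $\omega(t)\to\omega(0)=0$ as $t\to0^+$. $\mathbb{T}^N=\mathbb{R}^N/\mathbb{Z}^N$; functions on $\mathbb{T}^N$ are identified with $\mathbb{Z}^N$-periodic functions on $\mathbb{R}^N$. Viscosity solution is in the usual sense for first-order Hamilton–Jacobi equations. *)

theory Defs
  imports "HOL-Analysis.Analysis"
begin

definition modulus_of_continuity :: "(real \<Rightarrow> real) \<Rightarrow> bool" where
  "modulus_of_continuity \<omega> \<longleftrightarrow>
     mono_on {0..} \<omega> \<and> (\<forall>t\<ge>0. 0 \<le> \<omega> t) \<and> \<omega> 0 = 0 \<and> (\<omega> \<longlongrightarrow> 0) (at_right 0)"

definition Z_periodic :: "(real ^ 'n \<Rightarrow> real) \<Rightarrow> bool" where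
  "Z_periodic f \<longleftrightarrow> (\<forall>y k. (\<forall>i. k $ i \<in> \<int>) \<longrightarrow> f (y + k) = f y)"

text \<open>
  Viscosity sub- and supersolutions of \<open>F(y, u(y), Du(y)) = 0\<close> on the whole space, tested
  with \<open>\<phi> \<in> C\<^sup>1\<close> (whose gradient is \<open>G\<close>) at local extrema of \<open>u - \<phi>\<close>. The first conjunct
  is upper (lower) semicontinuity of \<open>u\<close>. An equation on the torus is read as an equation on
  the whole space for a periodic unknown.
\<close>

definition viscosity_subsolution ::
    "('a::euclidean_space \<Rightarrow> real \<Rightarrow> 'a \<Rightarrow> real) \<Rightarrow> ('a \<Rightarrow> real) \<Rightarrow> bool" where
  "viscosity_subsolution F u \<longleftrightarrow>
     (\<forall>y. \<forall>s > u y. eventually (\<lambda>z. u z < s) (nhds y)) \<and>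
     (\<forall>\<phi> G y. (\<forall>z. GDERIV \<phi> z :> G z) \<longrightarrow> continuous_on UNIV G \<longrightarrow>
        eventually (\<lambda>z. u z - \<phi> z \<le> u y - \<phi> y) (nhds y) \<longrightarrow> F y (u y) (G y) \<le> 0)"

definition viscosity_supersolution ::
    "('a::euclidean_space \<Rightarrow> real \<Rightarrow> 'a \<Rightarrow> real) \<Rightarrow> ('a \<Rightarrow> real) \<Rightarrow> bool" where
  "viscosity_supersolution F u \<longleftrightarrow>
     (\<forall>y. \<forall>s < u y. eventually (\<lambda>z. s < u z) (nhds y)) \<and>
     (\<forall>\<phi> G y. (\<forall>z. GDERIV \<phi> z :> G z) \<longrightarrow> continuous_on UNIV G \<longrightarrow>
        eventually (\<lambda>z. u y - \<phi> y \<le> u z - \<phi> z) (nhds y) \<longrightarrow> 0 \<le> F y (u y) (G y))"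

definition viscosity_solution ::
    "('a::euclidean_space \<Rightarrow> real \<Rightarrow> 'a \<Rightarrow> real) \<Rightarrow> ('a \<Rightarrow> real) \<Rightarrow> bool" where
  "viscosity_solution F u \<longleftrightarrow> viscosity_subsolution F u \<and> viscosity_supersolution F u"

end

theory Submission
  imports Defs "HOL-Complex_Analysis.Great_Picard"
begin

text \<open>
  With \<open>x\<close>, \<open>p\<close>, \<open>l\<close> fixed, \<open>G y q = - a x y l + H x y (p + q)\<close> is continuous, periodic in \<open>y\<close>
  and coercive in \<open>q\<close>, and the argument of Lions, Papanicolaou and Varadhan applies.
  For \<open>\<delta> > 0\<close> the equation \<open>\<delta> u + G(y, Du) = 0\<close> is solved by the supremum of all subsolutions
  bounded by \<open>M / \<delta>\<close>, where \<open>M = sup |G(\<cdot>, 0)|\<close>. Coercivity makes all of them Lipschitz with a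
  constant independent of \<open>\<delta>\<close>, so no comparison principle is needed, and the supremum is periodic
  because the family is invariant under integer translations. As \<open>\<delta> \<rightarrow> 0\<close>, subsequences of
  \<open>u - u(0)\<close> and \<open>- \<delta> u(0)\<close> converge to a solution and the constant of the cell problem.
  Uniqueness of the constant follows by doubling variables.
\<close>

section \<open>Test functions\<close>

lemma GDERIV_norm_power2:
  fixes y z :: "'a::real_inner"
  shows "GDERIV (\<lambda>z. (norm (z - y))\<^sup>2) z :> 2 *\<^sub>R (z - y)"
  unfolding gderiv_def power2_norm_eq_inner
  by (auto intro!: derivative_eq_intros simp: inner_commute algebra_simps)

lemma GDERIV_const_mult:
  assumes "GDERIV f x :> D"
  shows "GDERIV (\<lambda>x. k * f x) x :> k *\<^sub>R D"
  using GDERIV_mult[OF GDERIV_const assms, of k] by simp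

lemma GDERIV_shift:
  assumes "GDERIV f (x + k) :> D"
  shows "GDERIV (\<lambda>x. f (x + k)) x :> D"
proof -
  have "((\<lambda>x. x + k) has_derivative (\<lambda>h. h)) (at x)"
    by (auto intro!: derivative_eq_intros)
  from diff_chain_at[OF this] show ?thesis
    using assms by (simp add: gderiv_def o_def)
qed

lemma GDERIV_imp_continuous_on:
  assumes "\<And>z. GDERIV \<phi> z :> G z"
  shows "continuous_on UNIV \<phi>"
  using assms unfolding gderiv_def
  by (intro continuous_at_imp_continuous_on ballI) (blast intro: has_derivative_continuous)

text \<open>The differential of \<open>f - g\<close> vanishes at an interior maximum; evaluating it
  at \<open>h = D - E\<close> gives \<open>|D - E|^2 = 0\<close>. It identifies the gradient of a
  test function that touches a smooth function.\<close>

lemma GDERIV_local_max_eq: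
  fixes f g :: "'a::real_inner \<Rightarrow> real"
  assumes f: "GDERIV f y :> D" and g: "GDERIV g y :> E"
    and max: "eventually (\<lambda>z. f z - g z \<le> f y - g y) (nhds y)"
  shows "D = E"
proof -
  obtain S where S: "open S" "y \<in> S" "\<And>z. z \<in> S \<Longrightarrow> f z - g z \<le> f y - g y"
    using max unfolding eventually_nhds by blast
  have "((\<lambda>z. f z - g z) has_derivative (\<lambda>h. h \<bullet> (D - E))) (at y)"
    using GDERIV_diff[OF f g] by (simp add: gderiv_def)
  from differential_zero_maxmin[OF S(2,1) this] S(3)
  have "(\<lambda>h. h \<bullet> (D - E)) = (\<lambda>h. 0)" by blast
  then have "(D - E) \<bullet> (D - E) = 0" by metis
  then show ?thesis by simp
qed

section \<open>Viscosity sub- and supersolutions\<close>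

lemma continuous_on_imp_eventually_less:
  fixes u :: "'a::topological_space \<Rightarrow> real"
  assumes "continuous_on UNIV u" "u y < s"
  shows "eventually (\<lambda>z. u z < s) (nhds y)"
proof -
  have "open {z. u z < s}"
    using assms(1) by (intro open_Collect_less continuous_intros)
  then show ?thesis
    using assms(2) unfolding eventually_nhds by blast
qed

lemma viscosity_subsolutionI:
  assumes "continuous_on UNIV u"
    and "\<And>\<phi> G y. (\<And>z. GDERIV \<phi> z :> G z) \<Longrightarrow> continuous_on UNIV G \<Longrightarrow>
        eventually (\<lambda>z. u z - \<phi> z \<le> u y - \<phi> y) (nhds y) \<Longrightarrow> F y (u y) (G y) \<le> 0"
  shows "viscosity_subsolution F u"
  unfolding viscosity_subsolution_def
  using continuous_on_imp_eventually_less[OF assms(1)] assms(2) by blast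

lemma viscosity_subsolutionD:
  assumes "viscosity_subsolution F u"
    and "\<And>z. GDERIV \<phi> z :> G z" "continuous_on UNIV G"
    and "eventually (\<lambda>z. u z - \<phi> z \<le> u y - \<phi> y) (nhds y)"
  shows "F y (u y) (G y) \<le> 0"
  using assms unfolding viscosity_subsolution_def by blast

lemma viscosity_supersolutionD:
  assumes "viscosity_supersolution F u"
    and "\<And>z. GDERIV \<phi> z :> G z" "continuous_on UNIV G"
    and "eventually (\<lambda>z. u y - \<phi> y \<le> u z - \<phi> z) (nhds y)"
  shows "0 \<le> F y (u y) (G y)"
  using assms unfolding viscosity_supersolution_def by blast

text \<open>If \<open>\<phi>\<close> touches \<open>u\<close> from below, then
  \<open>- \<phi>\<close> touches \<open>- u\<close> from above with the gradient negated. Through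
  this reflection the shift and limit results for subsolutions carry over to supersolutions.\<close>

lemma viscosity_supersolution_iff_uminus:
  "viscosity_supersolution F u \<longleftrightarrow>
     viscosity_subsolution (\<lambda>y r q. - F y (- r) (- q)) (\<lambda>y. - u y)"
  (is "?L \<longleftrightarrow> ?R")
proof
  assume L: ?L
  show ?R
    unfolding viscosity_subsolution_def
  proof (intro conjI allI impI)
    fix y s assume "- u y < s"
    then have "- s < u y" by simp
    then have "eventually (\<lambda>z. - s < u z) (nhds y)"
      using L unfolding viscosity_supersolution_def by blast
    then show "eventually (\<lambda>z. - u z < s) (nhds y)"
      by (rule eventually_mono) simp
  next
    fix \<phi> G y
    assume "\<forall>z. GDERIV \<phi> z :> G z" "continuous_on UNIV G"
      and ev: "eventually (\<lambda>z. - u z - \<phi> z \<le> - u y - \<phi> y) (nhds y)"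
    then have "\<forall>z. GDERIV (\<lambda>z. - \<phi> z) z :> - G z" "continuous_on UNIV (\<lambda>z. - G z)"
      by (auto intro: GDERIV_minus continuous_intros)
    moreover have "eventually (\<lambda>z. u y - - \<phi> y \<le> u z - - \<phi> z) (nhds y)"
      using ev by (rule eventually_mono) simp
    ultimately have "0 \<le> F y (u y) (- G y)"
      by (intro viscosity_supersolutionD[OF L]) auto
    then show "- F y (- (- u y)) (- G y) \<le> 0" by simp
  qed
next
  assume R: ?R
  show ?L
    unfolding viscosity_supersolution_def
  proof (intro conjI allI impI)
    fix y s assume "s < u y"
    then have "- u y < - s" by simp
    then have "eventually (\<lambda>z. - u z < - s) (nhds y)"
      using R unfolding viscosity_subsolution_def by blast
    then show "eventually (\<lambda>z. s < u z) (nhds y)"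
      by (rule eventually_mono) simp
  next
    fix \<phi> G y
    assume "\<forall>z. GDERIV \<phi> z :> G z" "continuous_on UNIV G"
      and ev: "eventually (\<lambda>z. u y - \<phi> y \<le> u z - \<phi> z) (nhds y)"
    then have "\<And>z. GDERIV (\<lambda>z. - \<phi> z) z :> - G z" "continuous_on UNIV (\<lambda>z. - G z)"
      by (auto intro: GDERIV_minus continuous_intros)
    moreover have "eventually (\<lambda>z. - u z - - \<phi> z \<le> - u y - - \<phi> y) (nhds y)"
      using ev by (rule eventually_mono) simp
    ultimately show "0 \<le> F y (u y) (G y)"
      using viscosity_subsolutionD[OF R] by fastforce
  qed
qed

text \<open>A constant leaves gradients unchanged, so only the value slot of \<open>F\<close> moves.
  This serves to normalise the discounted solutions to vanish at \<open>0\<close>.\<close>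

lemma viscosity_subsolution_shift_value:
  assumes "viscosity_subsolution F u"
  shows "viscosity_subsolution (\<lambda>y r q. F y (r + k) q) (\<lambda>y. u y - k)"
  unfolding viscosity_subsolution_def
proof (intro conjI allI impI)
  fix y s assume "u y - k < s"
  then have "u y < s + k" by simp
  then have "eventually (\<lambda>z. u z < s + k) (nhds y)"
    using assms unfolding viscosity_subsolution_def by blast
  then show "eventually (\<lambda>z. u z - k < s) (nhds y)"
    by (rule eventually_mono) simp
next
  fix \<phi> G y
  assume \<phi>: "\<forall>z. GDERIV \<phi> z :> G z" "continuous_on UNIV G"
    and ev: "eventually (\<lambda>z. u z - k - \<phi> z \<le> u y - k - \<phi> y) (nhds y)"
  from ev have "eventually (\<lambda>z. u z - \<phi> z \<le> u y - \<phi> y) (nhds y)"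
    by (rule eventually_mono) simp
  with \<phi> have "F y (u y) (G y) \<le> 0"
    by (intro viscosity_subsolutionD[OF assms]) auto
  then show "F y (u y - k + k) (G y) \<le> 0" by simp
qed

lemma viscosity_supersolution_shift_value:
  assumes "viscosity_supersolution F u"
  shows "viscosity_supersolution (\<lambda>y r q. F y (r + k) q) (\<lambda>y. u y - k)"
  using viscosity_subsolution_shift_value
    [OF assms[unfolded viscosity_supersolution_iff_uminus], of "- k"]
  by (simp add: viscosity_supersolution_iff_uminus)

text \<open>A test function for the translate at \<open>y\<close>, precomposed with the shift by
  \<open>- k\<close>, is one for \<open>u\<close> at \<open>y + k\<close>. This is behind the
  periodicity of the Perron solution.\<close>

lemma viscosity_subsolution_translate:
  fixes u :: "'a::euclidean_space \<Rightarrow> real"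
  assumes sub: "viscosity_subsolution F u" and cont: "continuous_on UNIV u"
    and F: "\<And>y r q. F (y + k) r q = F y r q"
  shows "viscosity_subsolution F (\<lambda>y. u (y + k))"
proof (rule viscosity_subsolutionI)
  show "continuous_on UNIV (\<lambda>y. u (y + k))"
    by (rule continuous_on_compose2[OF cont]) (auto intro: continuous_intros)
next
  fix \<phi> G y
  assume \<phi>: "\<And>z. GDERIV \<phi> z :> G z" "continuous_on UNIV G"
    and ev: "eventually (\<lambda>z. u (z + k) - \<phi> z \<le> u (y + k) - \<phi> y) (nhds y)"
  obtain d where d: "d > 0"
    "\<And>z. dist z y < d \<Longrightarrow> u (z + k) - \<phi> z \<le> u (y + k) - \<phi> y"
    using ev unfolding eventually_nhds_metric by blast
  have "F (y + k) (u (y + k)) (G ((y + k) + - k)) \<le> 0"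
  proof (rule viscosity_subsolutionD[OF sub, of "\<lambda>z. \<phi> (z + - k)" "\<lambda>z. G (z + - k)"])
    show "GDERIV (\<lambda>z. \<phi> (z + - k)) z :> G (z + - k)" for z
      by (rule GDERIV_shift) (rule \<phi>)
    show "continuous_on UNIV (\<lambda>z. G (z + - k))"
      by (rule continuous_on_compose2[OF \<phi>(2)]) (auto intro: continuous_intros)
    show "eventually (\<lambda>z. u z - \<phi> (z + - k) \<le> u (y + k) - \<phi> (y + k + - k)) (nhds (y + k))"
      unfolding eventually_nhds_metric
    proof (intro exI[of _ d] conjI allI impI)
      fix z assume "dist z (y + k) < d"
      then have "dist (z - k) y < d" by (simp add: dist_norm algebra_simps)
      from d(2)[OF this] show "u z - \<phi> (z + - k) \<le> u (y + k) - \<phi> (y + k + - k)" by simp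
    qed (rule d)
  qed
  then show "F y (u (y + k)) (G y) \<le> 0" by (simp add: F)
qed

section \<open>Stability of subsolutions under limits\<close>

text \<open>
  Adding \<open>|z - y|\<^sup>2\<close> to the test function makes \<open>y\<close> a strict maximum, so that the maximum points
  of \<open>v n - \<phi> - |\<cdot> - y|\<^sup>2\<close> converge to \<open>y\<close>. Only a one-sided bound on \<open>v n - u\<close> is assumed
  away from \<open>y\<close>, so that the lemma covers suprema as well as uniform limits.
\<close>

lemma viscosity_subsolution_limit_at:
  fixes u :: "'a::euclidean_space \<Rightarrow> real"
  assumes u: "continuous_on UNIV u"
    and v: "\<And>n. continuous_on UNIV (v n)" "\<And>n. viscosity_subsolution (F n) (v n)"
    and le: "\<And>e. e > 0 \<Longrightarrow> eventually (\<lambda>n. \<forall>z. v n z \<le> u z + e) sequentially"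
    and vy: "(\<lambda>n. v n y) \<longlonglongrightarrow> u y"
    and F: "\<And>z r q p. z \<longlonglongrightarrow> y \<Longrightarrow> r \<longlonglongrightarrow> u y \<Longrightarrow> q \<longlonglongrightarrow> p \<Longrightarrow>
      (\<lambda>n. F n (z n) (r n) (q n)) \<longlonglongrightarrow> F' y (u y) p"
    and \<phi>: "\<And>z. GDERIV \<phi> z :> G z" "continuous_on UNIV G"
    and max: "eventually (\<lambda>z. u z - \<phi> z \<le> u y - \<phi> y) (nhds y)"
  shows "F' y (u y) (G y) \<le> 0"
proof -
  obtain d where d: "d > 0" "\<And>z. dist z y < d \<Longrightarrow> u z - \<phi> z \<le> u y - \<phi> y"
    using max unfolding eventually_nhds_metric by blast
  define r where "r = d / 2"
  have r: "r > 0" "r < d" using d(1) by (auto simp: r_def)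
  define \<xi> where "\<xi> z = \<phi> z + (norm (z - y))\<^sup>2" for z
  define E where "E z = G z + 2 *\<^sub>R (z - y)" for z
  have \<phi>_cont: "continuous_on UNIV \<phi>" using \<phi>(1) by (rule GDERIV_imp_continuous_on)
  have \<xi>: "GDERIV \<xi> z :> E z" for z
    unfolding \<xi>_def[abs_def] E_def by (intro GDERIV_add \<phi> GDERIV_norm_power2)
  have \<xi>_cont: "continuous_on UNIV \<xi>" using \<xi> by (rule GDERIV_imp_continuous_on)
  have E_cont: "continuous_on UNIV E" unfolding E_def[abs_def] by (intro continuous_intros \<phi>)
  have "\<exists>z\<in>cball y r. \<forall>w\<in>cball y r. v n w - \<xi> w \<le> v n z - \<xi> z" for n
    using r(1) by (intro continuous_attains_sup continuous_intros continuous_on_subset[OF v(1)]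
        continuous_on_subset[OF \<xi>_cont]) auto
  then obtain z where z: "\<And>n. z n \<in> cball y r"
    "\<And>n w. w \<in> cball y r \<Longrightarrow> v n w - \<xi> w \<le> v n (z n) - \<xi> (z n)"
    by metis
  have z_max: "v n y - \<phi> y + (norm (z n - y))\<^sup>2 \<le> v n (z n) - \<phi> (z n)" for n
    using z(2)[of y n] r(1) by (simp add: \<xi>_def)
  have u_max: "u (z n) - \<phi> (z n) \<le> u y - \<phi> y" for n
    using z(1)[of n] r by (intro d(2)) (auto simp: dist_commute)
  \<comment> \<open>Chaining \<open>z_max\<close>, the one-sided bound and \<open>u_max\<close>
    gives \<open>|z n - y|^2 \<le> (u y - v n y) + e / 2\<close> eventually.\<close>
  have "(\<lambda>n. (norm (z n - y))\<^sup>2) \<longlonglongrightarrow> 0"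
  proof (rule tendstoI)
    fix e :: real assume e: "e > 0"
    have "eventually (\<lambda>n. dist (v n y) (u y) < e / 2) sequentially"
      using e by (intro tendstoD[OF vy]) simp
    moreover have "eventually (\<lambda>n. \<forall>z. v n z \<le> u z + e / 2) sequentially"
      using e by (intro le) simp
    ultimately show "eventually (\<lambda>n. dist ((norm (z n - y))\<^sup>2) 0 < e) sequentially"
    proof eventually_elim
      case (elim n)
      have "v n (z n) \<le> u (z n) + e / 2" using elim by blast
      moreover have "u y - v n y < e / 2" using elim unfolding dist_real_def by linarith
      ultimately show ?case using z_max[of n] u_max[of n] by simp
    qed
  qed
  then have "(\<lambda>n. sqrt ((norm (z n - y))\<^sup>2)) \<longlonglongrightarrow> sqrt 0" by (rule tendsto_real_sqrt)
  then have "(\<lambda>n. z n - y) \<longlonglongrightarrow> 0" by (simp add: tendsto_norm_zero_iff)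
  then have z_lim: "z \<longlonglongrightarrow> y" by (simp add: LIM_zero_iff)
  have u_lim: "(\<lambda>n. u (z n)) \<longlonglongrightarrow> u y"
    by (rule continuous_on_tendsto_compose[OF u z_lim]) auto
  have \<phi>_lim: "(\<lambda>n. \<phi> (z n)) \<longlonglongrightarrow> \<phi> y"
    by (rule continuous_on_tendsto_compose[OF \<phi>_cont z_lim]) auto
  \<comment> \<open>From above, \<open>v n (z n) \<le> u (z n) + e / 2\<close> with \<open>u\<close>
    continuous; from below, \<open>z_max\<close> with the square dropped.\<close>
  have v_lim: "(\<lambda>n. v n (z n)) \<longlonglongrightarrow> u y"
  proof (rule tendstoI)
    fix e :: real assume e: "e > 0"
    have lim: "(\<lambda>n. v n y - \<phi> y + \<phi> (z n)) \<longlonglongrightarrow> u y - \<phi> y + \<phi> y"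
      by (intro tendsto_intros vy \<phi>_lim)
    have "eventually (\<lambda>n. dist (v n y - \<phi> y + \<phi> (z n)) (u y - \<phi> y + \<phi> y) < e) sequentially"
      by (rule tendstoD[OF lim e])
    moreover have "eventually (\<lambda>n. dist (u (z n)) (u y) < e / 2) sequentially"
      using e by (intro tendstoD[OF u_lim]) simp
    moreover have "eventually (\<lambda>n. \<forall>z. v n z \<le> u z + e / 2) sequentially"
      using e by (intro le) simp
    ultimately show "eventually (\<lambda>n. dist (v n (z n)) (u y) < e) sequentially"
    proof eventually_elim
      case (elim n)
      have "v n (z n) \<le> u (z n) + e / 2" using elim by blast
      moreover have "v n y - \<phi> y \<le> v n (z n) - \<phi> (z n)"
        using z_max[of n] by (smt (verit) zero_le_power2)
      ultimately show ?case using elim(1,2) unfolding dist_real_def by linarith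
    qed
  qed
  have "(\<lambda>n. E (z n)) \<longlonglongrightarrow> E y"
    by (rule continuous_on_tendsto_compose[OF E_cont z_lim]) auto
  from F[OF z_lim v_lim this] have lim: "(\<lambda>n. F n (z n) (v n (z n)) (E (z n))) \<longlonglongrightarrow> F' y (u y) (G y)"
    by (simp add: E_def)
  \<comment> \<open>Once \<open>z n\<close> lies in the open ball, its maximality over the closed
    ball is a local maximum of \<open>v n - \<xi>\<close>, so the subsolution test applies
    there.\<close>
  have "eventually (\<lambda>n. dist (z n) y < r) sequentially" by (rule tendstoD[OF z_lim r(1)])
  then have "eventually (\<lambda>n. F n (z n) (v n (z n)) (E (z n)) \<le> 0) sequentially"
  proof eventually_elim
    case (elim n)
    show ?case
    proof (rule viscosity_subsolutionD[OF v(2) \<xi> E_cont])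
      have "eventually (\<lambda>w. w \<in> ball y r) (nhds (z n))"
        using elim by (intro eventually_nhds_in_open) (auto simp: dist_commute)
      then show "eventually (\<lambda>w. v n w - \<xi> w \<le> v n (z n) - \<xi> (z n)) (nhds (z n))"
        by (rule eventually_mono) (intro z(2), simp)
    qed
  qed
  with lim show ?thesis by (intro tendsto_upperbound) auto
qed

text \<open>Uniform convergence makes \<open>u\<close> continuous and supplies both the one-sided
  bound and the limit at every point.\<close>

lemma viscosity_subsolution_uniform_limit:
  fixes u :: "'a::euclidean_space \<Rightarrow> real"
  assumes v: "\<And>n. continuous_on UNIV (v n)" "\<And>n. viscosity_subsolution (F n) (v n)"
    and lim: "uniform_limit UNIV v u sequentially"
    and F: "\<And>z r q y s p. z \<longlonglongrightarrow> y \<Longrightarrow> r \<longlonglongrightarrow> s \<Longrightarrow> q \<longlonglongrightarrow> p \<Longrightarrow>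
      (\<lambda>n. F n (z n) (r n) (q n)) \<longlonglongrightarrow> F' y s p"
  shows "viscosity_subsolution F' u"
proof -
  have u: "continuous_on UNIV u"
    using lim by (rule uniform_limit_theorem[rotated]) (auto simp: v)
  show ?thesis
  proof (rule viscosity_subsolutionI[OF u])
    fix \<phi> G y
    assume \<phi>: "\<And>z. GDERIV \<phi> z :> G z" "continuous_on UNIV G"
      and max: "eventually (\<lambda>z. u z - \<phi> z \<le> u y - \<phi> y) (nhds y)"
    show "F' y (u y) (G y) \<le> 0"
    proof (rule viscosity_subsolution_limit_at[OF u v _ _ F \<phi> max])
      show "eventually (\<lambda>n. \<forall>z. v n z \<le> u z + e) sequentially" if "e > 0" for e
      proof -
        have "eventually (\<lambda>n. \<forall>z\<in>UNIV. dist (v n z) (u z) < e) sequentially"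
          by (rule uniform_limitD[OF lim that])
        then show ?thesis
          by (rule eventually_mono) (auto simp: dist_real_def abs_less_iff algebra_simps less_imp_le)
      qed
      show "(\<lambda>n. v n y) \<longlonglongrightarrow> u y" using lim by (rule tendsto_uniform_limitI) simp
    qed
  qed
qed

lemma viscosity_supersolution_uniform_limit:
  fixes u :: "'a::euclidean_space \<Rightarrow> real"
  assumes v: "\<And>n. continuous_on UNIV (v n)" "\<And>n. viscosity_supersolution (F n) (v n)"
    and lim: "uniform_limit UNIV v u sequentially"
    and F: "\<And>z r q y s p. z \<longlonglongrightarrow> y \<Longrightarrow> r \<longlonglongrightarrow> s \<Longrightarrow> q \<longlonglongrightarrow> p \<Longrightarrow>
      (\<lambda>n. F n (z n) (r n) (q n)) \<longlonglongrightarrow> F' y s p"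
  shows "viscosity_supersolution F' u"
  unfolding viscosity_supersolution_iff_uminus
proof (rule viscosity_subsolution_uniform_limit)
  show "continuous_on UNIV (\<lambda>y. - v n y)" for n by (intro continuous_intros v)
  show "viscosity_subsolution (\<lambda>y r q. - F n y (- r) (- q)) (\<lambda>y. - v n y)" for n
    using v(2) by (simp add: viscosity_supersolution_iff_uminus)
  show "uniform_limit UNIV (\<lambda>n y. - v n y) (\<lambda>y. - u y) sequentially"
    by (rule uniform_limit_uminus[OF lim])
  show "(\<lambda>n. - F n (z n) (- r n) (- q n)) \<longlonglongrightarrow> - F' y (- s) (- p)"
    if "z \<longlonglongrightarrow> y" "r \<longlonglongrightarrow> s" "q \<longlonglongrightarrow> p" for z r q y s p
    by (intro tendsto_minus F that)
qed

section \<open>Lipschitz estimate from a gradient bound\<close>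

text \<open>The test function is a cone of slope \<open>K = R + 1\<close> smoothed at its vertex
  \<open>x\<close> on the scale \<open>\<eta>\<close>. Its gradient exceeds \<open>R\<close> in norm
  except near \<open>x\<close>, so \<open>v - \<phi> \<eta>\<close> can only peak near
  \<open>x\<close>; letting \<open>\<eta>\<close> tend to \<open>0\<close> yields
  \<open>v y - K |y - x| \<le> v x\<close>.\<close>

lemma gradient_bound_imp_lipschitz:
  fixes v :: "'a::euclidean_space \<Rightarrow> real"
  assumes cont: "continuous_on UNIV v" and bdd: "\<And>y. \<bar>v y\<bar> \<le> B" and R: "R \<ge> 0"
    and sub: "viscosity_subsolution (\<lambda>y r q. norm q - R) v"
  shows "(R + 1)-lipschitz_on UNIV v"
proof -
  define K where "K = R + 1"
  have K: "K > 0" "K > R" using R by (auto simp: K_def)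
  have main: "v y - K * norm (y - x) \<le> v x" for x y
  proof -
    define \<phi> where "\<phi> \<eta> z = K * sqrt ((norm (z - x))\<^sup>2 + \<eta>\<^sup>2)" for \<eta> z
    have "\<exists>z. (norm (z - x))\<^sup>2 \<le> R\<^sup>2 / (K\<^sup>2 - R\<^sup>2) * \<eta>\<^sup>2 \<and> v y - \<phi> \<eta> y \<le> v z" if \<eta>: "\<eta> > 0" for \<eta>
    proof -
      \<comment> \<open>Outside this ball
        \<open>\<phi> \<eta> \<ge> K * \<rho> = 2 * B + K * \<eta>\<close>, while
        \<open>\<phi> \<eta> x = K * \<eta>\<close> and \<open>|v| \<le> B\<close>. Hence the
        maximum over the ball is global.\<close>
      define \<rho> where "\<rho> = (2 * B + K * \<eta>) / K"
      have B: "B \<ge> 0" using bdd[of x] by linarith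
      have \<rho>: "\<rho> \<ge> 0" using B K \<eta> by (simp add: \<rho>_def)
      have pos: "(norm (z - x))\<^sup>2 + \<eta>\<^sup>2 > 0" for z
        using \<eta> by (simp add: add_nonneg_pos)
      have \<phi>_cont: "continuous_on A (\<phi> \<eta>)" for A
        unfolding \<phi>_def[abs_def] by (intro continuous_intros)
      have "\<exists>z\<in>cball x \<rho>. \<forall>w\<in>cball x \<rho>. v w - \<phi> \<eta> w \<le> v z - \<phi> \<eta> z"
        using \<rho> by (intro continuous_attains_sup continuous_intros \<phi>_cont
            continuous_on_subset[OF cont]) auto
      then obtain z where z: "z \<in> cball x \<rho>"
        "\<And>w. w \<in> cball x \<rho> \<Longrightarrow> v w - \<phi> \<eta> w \<le> v z - \<phi> \<eta> z" by blast
      have z_max: "v w - \<phi> \<eta> w \<le> v z - \<phi> \<eta> z" for w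
      proof (cases "w \<in> cball x \<rho>")
        case False
        then have "\<rho> \<le> norm (w - x)" by (simp add: dist_norm norm_minus_commute)
        then have "K * \<rho> \<le> K * norm (w - x)" using K by simp
        also have "\<dots> \<le> \<phi> \<eta> w"
          unfolding \<phi>_def using K by (intro mult_left_mono real_le_rsqrt) auto
        finally have "2 * B + K * \<eta> \<le> \<phi> \<eta> w" using K by (simp add: \<rho>_def)
        then have "v w - \<phi> \<eta> w \<le> v x - \<phi> \<eta> x"
          using bdd[of w] bdd[of x] \<eta> by (simp add: \<phi>_def)
        also have "\<dots> \<le> v z - \<phi> \<eta> z" using \<rho> by (intro z) simp
        finally show ?thesis .
      qed (rule z)
      define E where "E z = (K / sqrt ((norm (z - x))\<^sup>2 + \<eta>\<^sup>2)) *\<^sub>R (z - x)" for z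
      have "norm (E z) - R \<le> 0"
      proof (rule viscosity_subsolutionD[OF sub, of "\<phi> \<eta>" E])
        fix w
        have "GDERIV (\<lambda>z. (norm (z - x))\<^sup>2 + \<eta>\<^sup>2) w :> 2 *\<^sub>R (w - x) + 0"
          by (intro GDERIV_add GDERIV_norm_power2 GDERIV_const)
        from GDERIV_const_mult[OF GDERIV_DERIV_compose[OF this DERIV_real_sqrt[OF pos]], of K]
        show "GDERIV (\<phi> \<eta>) w :> E w"
          unfolding \<phi>_def[abs_def] E_def by (simp add: field_simps)
      next
        show "continuous_on UNIV E"
          unfolding E_def[abs_def] using pos
          by (intro continuous_intros ballI) (metis less_irrefl real_sqrt_eq_zero_cancel_iff)
        show "eventually (\<lambda>w. v w - \<phi> \<eta> w \<le> v z - \<phi> \<eta> z) (nhds z)"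
          by (simp add: z_max)
      qed
      \<comment> \<open>Squaring this and using \<open>R < K\<close> confines \<open>z\<close> to a
        distance of order \<open>\<eta>\<close> from \<open>x\<close>.\<close>
      then have "K * norm (z - x) \<le> R * sqrt ((norm (z - x))\<^sup>2 + \<eta>\<^sup>2)"
        using K pos[of z] by (simp add: E_def divide_le_eq)
      then have "(K * norm (z - x))\<^sup>2 \<le> (R * sqrt ((norm (z - x))\<^sup>2 + \<eta>\<^sup>2))\<^sup>2"
        using K by (intro power_mono) auto
      then have "(norm (z - x))\<^sup>2 * (K\<^sup>2 - R\<^sup>2) \<le> R\<^sup>2 * \<eta>\<^sup>2"
        using less_imp_le[OF pos[of z]]
        by (simp add: power_mult_distrib algebra_simps)
      moreover have "K\<^sup>2 - R\<^sup>2 > 0" using K R by (simp add: power_strict_mono)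
      ultimately have "(norm (z - x))\<^sup>2 \<le> R\<^sup>2 / (K\<^sup>2 - R\<^sup>2) * \<eta>\<^sup>2"
        by (simp add: field_simps)
      moreover have "v y - \<phi> \<eta> y \<le> v z"
        using z_max[of y] K unfolding \<phi>_def by (smt (verit) mult_nonneg_nonneg real_sqrt_ge_zero
          zero_le_power2)
      ultimately show ?thesis by blast
    qed
    then have "\<exists>z. (norm (z - x))\<^sup>2 \<le> R\<^sup>2 / (K\<^sup>2 - R\<^sup>2) * (inverse (real (Suc n)))\<^sup>2
        \<and> v y - \<phi> (inverse (real (Suc n))) y \<le> v z" for n
      by simp
    then obtain z where z: "\<And>n. (norm (z n - x))\<^sup>2 \<le> R\<^sup>2 / (K\<^sup>2 - R\<^sup>2) * (inverse (real (Suc n)))\<^sup>2"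
      "\<And>n. v y - \<phi> (inverse (real (Suc n))) y \<le> v (z n)"
      by metis
    have "(\<lambda>n. R\<^sup>2 / (K\<^sup>2 - R\<^sup>2) * (inverse (real (Suc n)))\<^sup>2) \<longlonglongrightarrow> R\<^sup>2 / (K\<^sup>2 - R\<^sup>2) * 0\<^sup>2"
      by (intro tendsto_intros LIMSEQ_inverse_real_of_nat)
    then have lim0: "(\<lambda>n. R\<^sup>2 / (K\<^sup>2 - R\<^sup>2) * (inverse (real (Suc n)))\<^sup>2) \<longlonglongrightarrow> 0" by simp
    have "(\<lambda>n. (norm (z n - x))\<^sup>2) \<longlonglongrightarrow> 0"
      by (rule tendsto_sandwich[OF _ _ tendsto_const lim0]) (use z(1) in auto)
    then have "(\<lambda>n. sqrt ((norm (z n - x))\<^sup>2)) \<longlonglongrightarrow> sqrt 0" by (rule tendsto_real_sqrt)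
    then have "(\<lambda>n. z n - x) \<longlonglongrightarrow> 0" by (simp add: tendsto_norm_zero_iff)
    then have "z \<longlonglongrightarrow> x" by (simp add: LIM_zero_iff)
    then have v_lim: "(\<lambda>n. v (z n)) \<longlonglongrightarrow> v x"
      by (rule continuous_on_tendsto_compose[OF cont]) auto
    have "(\<lambda>n. v y - \<phi> (inverse (real (Suc n))) y) \<longlonglongrightarrow> v y - K * sqrt ((norm (y - x))\<^sup>2 + 0\<^sup>2)"
      unfolding \<phi>_def by (intro tendsto_intros LIMSEQ_inverse_real_of_nat)
    from LIMSEQ_le[OF this v_lim] z(2) show ?thesis by auto
  qed
  show ?thesis
  proof (rule lipschitz_onI)
    fix x y
    show "dist (v x) (v y) \<le> (R + 1) * dist x y"
      using main[of x y] main[of y x]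
      by (simp add: dist_norm norm_minus_commute K_def abs_le_iff)
  qed (use R in simp)
qed

section \<open>Perron's method for the discounted equation\<close>

text \<open>When \<open>|G y 0| \<le> M\<close>, the constants \<open>- (M / \<delta>)\<close> and
  \<open>M / \<delta>\<close> are a sub- and a supersolution; they serve as barriers for the
  class.\<close>

definition discounted_subsolutions ::
    "real \<Rightarrow> real \<Rightarrow> ('a::euclidean_space \<Rightarrow> 'a \<Rightarrow> real) \<Rightarrow> ('a \<Rightarrow> real) set" where
  "discounted_subsolutions \<delta> M G =
     {v. continuous_on UNIV v \<and> (\<forall>y. \<bar>v y\<bar> \<le> M / \<delta>) \<and>
         viscosity_subsolution (\<lambda>y r q. \<delta> * r + G y q) v}"

definition perron_solution ::
    "real \<Rightarrow> real \<Rightarrow> ('a::euclidean_space \<Rightarrow> 'a \<Rightarrow> real) \<Rightarrow> 'a \<Rightarrow> real" where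
  "perron_solution \<delta> M G y = (SUP v\<in>discounted_subsolutions \<delta> M G. v y)"

locale coercive_hamiltonian =
  fixes G :: "'a::euclidean_space \<Rightarrow> 'a \<Rightarrow> real" and M R \<delta> :: real
  assumes G_cont: "continuous_on UNIV (\<lambda>(y, q). G y q)"
    and G_0: "\<And>y. \<bar>G y 0\<bar> \<le> M"
    and R_nonneg: "R \<ge> 0" and G_coercive: "\<And>y q. G y q \<le> M \<Longrightarrow> norm q \<le> R"
    and \<delta>_pos: "\<delta> > 0"
begin

abbreviation "S \<equiv> discounted_subsolutions \<delta> M G"
abbreviation "u \<equiv> perron_solution \<delta> M G"

lemma G_tendsto: "(f \<longlongrightarrow> y) A \<Longrightarrow> (g \<longlongrightarrow> q) A \<Longrightarrow> ((\<lambda>n. G (f n) (g n)) \<longlongrightarrow> G y q) A"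
  using continuous_on_tendsto_compose[OF G_cont, of "\<lambda>n. (f n, g n)" "(y, q)" A]
  by (auto intro: tendsto_Pair)

text \<open>The lower barrier gives \<open>\<delta> * v y \<ge> - M\<close>, so the equation forces
  \<open>G y q \<le> M\<close> and hence \<open>norm q \<le> R\<close>. The resulting constant does
  not involve \<open>\<delta>\<close>.\<close>

lemma S_lipschitz:
  assumes "v \<in> S"
  shows "(R + 1)-lipschitz_on UNIV v"
proof (rule gradient_bound_imp_lipschitz)
  have v: "continuous_on UNIV v" "\<And>y. \<bar>v y\<bar> \<le> M / \<delta>"
    "viscosity_subsolution (\<lambda>y r q. \<delta> * r + G y q) v"
    using assms by (auto simp: discounted_subsolutions_def)
  then show "continuous_on UNIV v" "\<And>y. \<bar>v y\<bar> \<le> M / \<delta>" by auto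
  show "viscosity_subsolution (\<lambda>y r q. norm q - R) v"
  proof (rule viscosity_subsolutionI[OF v(1)])
    fix \<phi> E y
    assume "\<And>z. GDERIV \<phi> z :> E z" "continuous_on UNIV E"
      "eventually (\<lambda>z. v z - \<phi> z \<le> v y - \<phi> y) (nhds y)"
    from viscosity_subsolutionD[OF v(3) this] have le: "\<delta> * v y + G y (E y) \<le> 0" .
    have "- (M / \<delta>) \<le> v y" using v(2)[of y] by linarith
    then have "\<delta> * - (M / \<delta>) \<le> \<delta> * v y" using \<delta>_pos by (intro mult_left_mono) auto
    then have "- M \<le> \<delta> * v y" using \<delta>_pos by simp
    then show "norm (E y) - R \<le> 0" using le G_coercive[of y "E y"] by simp
  qed
qed (rule R_nonneg)

text \<open>A test function touching a constant has zero gradient, where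
  \<open>G y 0 \<le> M\<close>. The class is thus nonempty and its supremum meaningful.\<close>

lemma const_in_S: "(\<lambda>y. - (M / \<delta>)) \<in> S"
proof -
  have "viscosity_subsolution (\<lambda>y r q. \<delta> * r + G y q) (\<lambda>y. - (M / \<delta>))"
  proof (rule viscosity_subsolutionI)
    fix \<phi> E and y :: 'a
    assume \<phi>: "\<And>z. GDERIV \<phi> z :> E z"
      and "eventually (\<lambda>z. - (M / \<delta>) - \<phi> z \<le> - (M / \<delta>) - \<phi> y) (nhds y)"
    then have "0 = E y"
      by (intro GDERIV_local_max_eq[OF GDERIV_const \<phi>, of "- (M / \<delta>)"])
    then show "\<delta> * - (M / \<delta>) + G y (E y) \<le> 0"
      using G_0[of y] \<delta>_pos by simp
  qed (rule continuous_on_const)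
  moreover have "M \<ge> 0" using G_0 by (meson abs_ge_zero order_trans)
  ultimately show ?thesis
    using \<delta>_pos by (simp add: discounted_subsolutions_def)
qed

lemma S_bound: "v \<in> S \<Longrightarrow> \<bar>v y\<bar> \<le> M / \<delta>"
  by (simp add: discounted_subsolutions_def)

lemma S_bdd_above: "bdd_above ((\<lambda>v. v y) ` S)"
  using S_bound by (intro bdd_aboveI2[where M = "M / \<delta>"]) (simp add: abs_le_iff)

lemma S_le_u: "v \<in> S \<Longrightarrow> v y \<le> u y"
  unfolding perron_solution_def by (rule cSUP_upper[OF _ S_bdd_above])

lemma u_le: "(\<And>v. v \<in> S \<Longrightarrow> v y \<le> B) \<Longrightarrow> u y \<le> B"
  unfolding perron_solution_def using const_in_S by (intro cSUP_least) auto

lemma u_bound: "\<bar>u y\<bar> \<le> M / \<delta>"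
proof -
  have "u y \<le> M / \<delta>" using S_bound by (intro u_le) (simp add: abs_le_iff)
  then show ?thesis using S_le_u[OF const_in_S, of y] by simp
qed

lemma u_lipschitz: "(R + 1)-lipschitz_on UNIV u"
proof -
  have le: "u x \<le> u y + (R + 1) * dist x y" for x y
  proof (rule u_le)
    fix v assume v: "v \<in> S"
    have "dist (v x) (v y) \<le> (R + 1) * dist x y"
      using lipschitz_onD[OF S_lipschitz[OF v]] by simp
    then show "v x \<le> u y + (R + 1) * dist x y"
      using S_le_u[OF v, of y] by (simp add: dist_real_def)
  qed
  show ?thesis
  proof (rule lipschitz_onI)
    fix x y show "dist (u x) (u y) \<le> (R + 1) * dist x y"
      using le[of x y] le[of y x] by (simp add: dist_real_def dist_commute abs_le_iff)
  qed (use R_nonneg in simp)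
qed

lemma u_cont: "continuous_on UNIV u"
  using u_lipschitz by (rule lipschitz_on_continuous_on)

text \<open>It suffices to take members of \<open>S\<close> approaching \<open>u\<close> at the
  single point \<open>y\<close>: they lie below \<open>u\<close> everywhere, which is the one-sided
  bound of the limit lemma.\<close>

lemma u_subsolution: "viscosity_subsolution (\<lambda>y r q. \<delta> * r + G y q) u"
proof (rule viscosity_subsolutionI[OF u_cont])
  fix \<phi> E y
  assume \<phi>: "\<And>z. GDERIV \<phi> z :> E z" "continuous_on UNIV E"
    and max: "eventually (\<lambda>z. u z - \<phi> z \<le> u y - \<phi> y) (nhds y)"
  have "\<exists>v\<in>S. u y - inverse (real (Suc n)) < v y" for n
  proof (rule ccontr)
    assume "\<not> ?thesis"
    then have "u y \<le> u y - inverse (real (Suc n))" by (intro u_le) (auto simp: not_less)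
    then show False by simp
  qed
  then obtain v where v: "\<And>n. v n \<in> S" "\<And>n. u y - inverse (real (Suc n)) < v n y"
    by metis
  have lim: "(\<lambda>n. u y - inverse (real (Suc n))) \<longlonglongrightarrow> u y - 0"
    by (intro tendsto_intros LIMSEQ_inverse_real_of_nat)
  have vy: "(\<lambda>n. v n y) \<longlonglongrightarrow> u y"
  proof (rule tendsto_sandwich[OF _ _ _ tendsto_const])
    show "eventually (\<lambda>n. u y - inverse (real (Suc n)) \<le> v n y) sequentially"
      using v(2) by (intro always_eventually allI less_imp_le)
  qed (use lim v(1) S_le_u in auto)
  show "\<delta> * u y + G y (E y) \<le> 0"
  proof (rule viscosity_subsolution_limit_at
      [OF u_cont, where v = v and F = "\<lambda>_ y r q. \<delta> * r + G y q" and F' = "\<lambda>y r q. \<delta> * r + G y q",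
        OF _ _ _ vy _ \<phi> max])
    show "continuous_on UNIV (v n)" "viscosity_subsolution (\<lambda>y r q. \<delta> * r + G y q) (v n)" for n
      using v(1)[of n] by (auto simp: discounted_subsolutions_def)
    show "eventually (\<lambda>n. \<forall>z. v n z \<le> u z + e) sequentially" if "e > 0" for e
      using S_le_u[OF v(1)] that by (intro always_eventually allI add_increasing2) auto
  qed (intro tendsto_intros G_tendsto)
qed

text \<open>
  If the supersolution property failed at \<open>y\<close>, replacing \<open>u\<close> near \<open>y\<close> by the maximum of \<open>u\<close>
  and a slightly raised strictly touching test function would give a larger subsolution.
\<close>

lemma u_supersolution: "viscosity_supersolution (\<lambda>y r q. \<delta> * r + G y q) u"
proof -
  have "0 \<le> \<delta> * u y + G y (E y)"
    if \<phi>: "\<And>z. GDERIV \<phi> z :> E z" "continuous_on UNIV E"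
      and min: "eventually (\<lambda>z. u y - \<phi> y \<le> u z - \<phi> z) (nhds y)" for \<phi> E y
  proof (rule ccontr)
    assume "\<not> ?thesis"
    then have neg: "\<delta> * u y + G y (E y) < 0" by simp
    \<comment> \<open>There must be room below the upper barrier. At a point where \<open>u\<close>
      reaches it, \<open>\<phi>\<close> has a local maximum, so \<open>E y = 0\<close> and
      \<open>\<delta> * u y + G y 0 = M + G y 0 \<ge> 0\<close>, against \<open>neg\<close>.\<close>
    have u_less: "u y < M / \<delta>"
    proof (rule ccontr)
      assume "\<not> ?thesis"
      then have uy: "u y = M / \<delta>" using u_bound[of y] by linarith
      have "eventually (\<lambda>z. \<phi> z - 0 \<le> \<phi> y - 0) (nhds y)"
        using min
      proof eventually_elim
        case (elim z)
        then show ?case using u_bound[of z] uy by simp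
      qed
      then have "E y = 0"
        by (intro GDERIV_local_max_eq[OF \<phi>(1) GDERIV_const])
      then show False using neg uy \<delta>_pos G_0[of y] by (simp add: abs_le_iff)
    qed
    define \<psi> where "\<psi> z = \<phi> z - (norm (z - y))\<^sup>2 + (u y - \<phi> y)" for z
    define D where "D z = E z - 2 *\<^sub>R (z - y) + 0" for z
    have \<psi>: "GDERIV \<psi> z :> D z" for z
      unfolding \<psi>_def[abs_def] D_def
      by (intro GDERIV_add GDERIV_diff \<phi> GDERIV_norm_power2 GDERIV_const)
    have \<psi>_cont: "continuous_on UNIV \<psi>" using \<psi> by (rule GDERIV_imp_continuous_on)
    have D_cont: "continuous_on UNIV D" unfolding D_def[abs_def] by (intro continuous_intros \<phi>)
    have \<psi>y: "\<psi> y = u y" and Dy: "D y = E y" by (auto simp: \<psi>_def D_def)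
    \<comment> \<open>\<open>\<theta>\<close> is half the amount by which the inequality fails at
      \<open>y\<close>, \<open>\<kappa>\<close> half the gap to the barrier; by continuity both
      halves survive near \<open>y\<close>.\<close>
    define \<theta> where "\<theta> = - (\<delta> * u y + G y (E y)) / 2"
    define \<kappa> where "\<kappa> = (M / \<delta> - u y) / 2"
    have pos: "\<theta> > 0" "\<kappa> > 0" using neg u_less by (auto simp: \<theta>_def \<kappa>_def)
    have "continuous_on UNIV (\<lambda>z. G z (D z))"
      using continuous_on_compose2[OF G_cont, of UNIV "\<lambda>z. (z, D z)"] D_cont
      by (simp add: continuous_on_Pair)
    then have "continuous_on UNIV (\<lambda>z. \<delta> * \<psi> z + G z (D z))"
      by (intro continuous_intros \<psi>_cont)
    then have "eventually (\<lambda>z. \<delta> * \<psi> z + G z (D z) < - \<theta>) (nhds y)"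
      by (rule continuous_on_imp_eventually_less) (use neg in \<open>simp add: \<psi>y Dy \<theta>_def field_simps\<close>)
    moreover have "eventually (\<lambda>z. \<psi> z < M / \<delta> - \<kappa>) (nhds y)"
      using \<psi>_cont by (rule continuous_on_imp_eventually_less)
        (use u_less in \<open>simp add: \<psi>y \<kappa>_def field_simps\<close>)
    ultimately have "eventually (\<lambda>z. \<delta> * \<psi> z + G z (D z) < - \<theta> \<and> \<psi> z < M / \<delta> - \<kappa> \<and>
        u y - \<phi> y \<le> u z - \<phi> z) (nhds y)"
      using min by eventually_elim simp
    then obtain r where r: "r > 0"
      and near: "\<And>z. dist z y < r \<Longrightarrow> \<delta> * \<psi> z + G z (D z) < - \<theta> \<and> \<psi> z < M / \<delta> - \<kappa> \<and>
        u y - \<phi> y \<le> u z - \<phi> z"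
      unfolding eventually_nhds_metric by blast
    \<comment> \<open>The three bounds ensure in turn that the raised function
      \<open>\<psi> + \<epsilon>\<close> is still a strict subsolution near \<open>y\<close>, stays
      below the barrier, and does not exceed \<open>u\<close> at distance beyond
      \<open>r / 2\<close> from \<open>y\<close>.\<close>
    define \<epsilon> where "\<epsilon> = min (\<theta> / \<delta>) (min \<kappa> ((r / 2)\<^sup>2))"
    have \<epsilon>: "\<epsilon> > 0" "\<epsilon> \<le> \<theta> / \<delta>" "\<epsilon> \<le> \<kappa>" "\<epsilon> \<le> (r / 2)\<^sup>2"
      using pos \<delta>_pos r by (auto simp: \<epsilon>_def)
    define w where "w z = (if z \<in> ball y r then max (u z) (\<psi> z + \<epsilon>) else u z)" for z
    have w_ge: "u z \<le> w z" for z by (simp add: w_def)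
    have w_eq_u: "w z = u z" if "r / 2 < dist z y" for z
    proof (cases "z \<in> ball y r")
      case True
      then have "u y - \<phi> y \<le> u z - \<phi> z" using near by (simp add: dist_commute)
      moreover have "(r / 2)\<^sup>2 \<le> (norm (z - y))\<^sup>2"
        using that r by (intro power_mono) (auto simp: dist_norm)
      ultimately have "\<psi> z + \<epsilon> \<le> u z" using \<epsilon>(4) by (simp add: \<psi>_def)
      then show ?thesis by (simp add: w_def)
    qed (simp add: w_def)
    \<comment> \<open>The two definitions agree on the annulus between \<open>r / 2\<close> and
      \<open>r\<close>, so \<open>w\<close> is continuous on two open sets covering the
      space.\<close>
    have w_cont: "continuous_on UNIV w"
    proof -
      have "continuous_on (ball y r) (\<lambda>z. max (u z) (\<psi> z + \<epsilon>))"
        by (intro continuous_intros continuous_on_subset[OF u_cont] continuous_on_subset[OF \<psi>_cont]) auto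
      then have "continuous_on (ball y r) w"
        by (rule continuous_on_eq) (simp add: w_def)
      moreover have "continuous_on (- cball y (r / 2)) w"
        by (rule continuous_on_eq[OF continuous_on_subset[OF u_cont]])
          (auto simp: w_eq_u dist_commute)
      ultimately have "continuous_on (ball y r \<union> - cball y (r / 2)) w"
        by (intro continuous_on_open_Un) auto
      moreover have "ball y r \<union> - cball y (r / 2) = UNIV" using r by auto
      ultimately show ?thesis by simp
    qed
    have w_bound: "\<bar>w z\<bar> \<le> M / \<delta>" for z
    proof -
      have "\<psi> z + \<epsilon> \<le> M / \<delta>" if "z \<in> ball y r"
        using near[of z] that \<epsilon>(3) by (auto simp: dist_commute)
      then have "w z \<le> M / \<delta>" using u_bound[of z] by (auto simp: w_def)
      then show ?thesis using w_ge[of z] u_bound[of z] by linarith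
    qed
    have "viscosity_subsolution (\<lambda>y r q. \<delta> * r + G y q) w"
    proof (rule viscosity_subsolutionI[OF w_cont])
      fix \<xi> X z
      assume \<xi>: "\<And>z. GDERIV \<xi> z :> X z" "continuous_on UNIV X"
        and max: "eventually (\<lambda>x. w x - \<xi> x \<le> w z - \<xi> z) (nhds z)"
      show "\<delta> * w z + G z (X z) \<le> 0"
      \<comment> \<open>A test function for \<open>w\<close> at \<open>z\<close> touches whichever
        of \<open>u\<close> and \<open>\<psi> + \<epsilon>\<close> attains the maximum there; in the
        second case its gradient is \<open>D z\<close>.\<close>
      proof (cases "w z = u z")
        case True
        have "eventually (\<lambda>x. u x - \<xi> x \<le> u z - \<xi> z) (nhds z)"
          using max
        proof eventually_elim
          case (elim x)
          then show ?case using w_ge[of x] True by linarith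
        qed
        from viscosity_subsolutionD[OF u_subsolution \<xi> this] show ?thesis by (simp add: True)
      next
        case False
        then have z: "z \<in> ball y r" and wz: "w z = \<psi> z + \<epsilon>"
          by (auto simp: w_def max_def split: if_splits)
        have "eventually (\<lambda>x. x \<in> ball y r) (nhds z)"
          using z by (intro eventually_nhds_in_open) auto
        with max have "eventually (\<lambda>x. \<psi> x - \<xi> x \<le> \<psi> z - \<xi> z) (nhds z)"
        proof eventually_elim
          case (elim x)
          then have "\<psi> x + \<epsilon> \<le> w x" by (simp add: w_def)
          then show ?case using elim wz by linarith
        qed
        then have "D z = X z" by (rule GDERIV_local_max_eq[OF \<psi> \<xi>(1)])
        moreover have "\<delta> * \<psi> z + G z (D z) < - \<theta>" using near z by (simp add: dist_commute)
        moreover have "\<delta> * \<epsilon> \<le> \<theta>" using \<epsilon>(2) \<delta>_pos by (simp add: field_simps)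
        ultimately show ?thesis by (simp add: wz distrib_left)
      qed
    qed
    with w_cont w_bound have "w \<in> S" by (simp add: discounted_subsolutions_def)
    from S_le_u[OF this, of y] show False
      using r \<epsilon>(1) by (simp add: w_def \<psi>y)
  qed
  moreover have "eventually (\<lambda>z. s < u z) (nhds y)" if "s < u y" for s y
    using continuous_on_imp_eventually_less[of "\<lambda>z. - u z" y "- s"] u_cont that
    by (simp add: continuous_on_minus)
  ultimately show ?thesis unfolding viscosity_supersolution_def by blast
qed

text \<open>Translation by \<open>h\<close> maps \<open>S\<close> into itself when \<open>G\<close>
  is invariant under \<open>h\<close>, so \<open>u (y + h) \<le> u y\<close>; the cases
  \<open>k\<close> and \<open>- k\<close> together give equality.\<close>

lemma u_translate:
  assumes "\<And>y q. G (y + k) q = G y q" "\<And>y q. G (y - k) q = G y q"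
  shows "u (y + k) = u y"
proof -
  have le: "u (y + h) \<le> u y" if h: "\<And>y q. G (y + h) q = G y q" for y h
  proof (rule u_le)
    fix v assume v: "v \<in> S"
    then have v': "continuous_on UNIV v" "\<And>y. \<bar>v y\<bar> \<le> M / \<delta>"
      "viscosity_subsolution (\<lambda>y r q. \<delta> * r + G y q) v"
      by (auto simp: discounted_subsolutions_def)
    have "viscosity_subsolution (\<lambda>y r q. \<delta> * r + G y q) (\<lambda>y. v (y + h))"
      by (rule viscosity_subsolution_translate[OF v'(3,1)]) (simp add: h)
    moreover have "continuous_on UNIV (\<lambda>y. v (y + h))"
      by (rule continuous_on_compose2[OF v'(1)]) (auto intro: continuous_intros)
    ultimately have "(\<lambda>y. v (y + h)) \<in> S"
      using v'(2) by (simp add: discounted_subsolutions_def)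
    from S_le_u[OF this] show "v (y + h) \<le> u y" .
  qed
  show ?thesis
    using le[of k y] le[of "- k" "y + k"] assms by simp
qed

end

section \<open>The cell problem for a coercive periodic Hamiltonian\<close>

text \<open>Coordinatewise floors give \<open>k\<close>. Bounds and maxima of periodic functions
  thereby reduce to a compact set.\<close>

lemma integer_translate_in_unit_cube:
  fixes y :: "real ^ 'n"
  obtains z k where "z \<in> cbox 0 (vec 1)" "\<forall>i. k $ i \<in> \<int>" "y = z + k"
proof -
  let ?k = "(\<chi> i. real_of_int \<lfloor>y $ i\<rfloor>) :: real ^ 'n"
  have "y - ?k \<in> cbox 0 (vec 1)"
    unfolding mem_box_cart
  proof
    fix i
    have "y $ i - of_int \<lfloor>y $ i\<rfloor> \<le> 1"
      using real_of_int_floor_add_one_ge[of "y $ i"] by linarith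
    then show "(0 :: real ^ 'n) $ i \<le> (y - ?k) $ i \<and> (y - ?k) $ i \<le> (vec 1 :: real ^ 'n) $ i"
      by simp
  qed
  then show ?thesis by (rule that[of "y - ?k" ?k]) auto
qed

lemma Z_periodicD: "Z_periodic f \<Longrightarrow> (\<forall>i. k $ i \<in> \<int>) \<Longrightarrow> f (y + k) = f y"
  by (simp add: Z_periodic_def)

lemma unit_cube_compact: "compact (cbox 0 (vec 1 :: real ^ 'n))"
  and unit_cube_nonempty: "cbox 0 (vec 1 :: real ^ 'n) \<noteq> {}"
  by (auto simp: interval_ne_empty_cart)

section \<open>Uniqueness of the constant by doubling variables\<close>

text \<open>At a maximum of the doubled function both equations are tested with the same gradient.
  The Lipschitz bound on \<open>v\<close> keeps this gradient bounded as the penalty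
  \<open>N\<close> grows, so a limit point exists at which \<open>d \<le> G \<le> c\<close>.\<close>

lemma viscosity_comparison_of_constants:
  fixes G :: "real ^ 'n \<Rightarrow> real ^ 'n \<Rightarrow> real"
  assumes G_cont: "continuous_on UNIV (\<lambda>(y, q). G y q)"
    and u: "Z_periodic u" "continuous_on UNIV u" "viscosity_subsolution (\<lambda>y r q. G y q - c) u"
    and v: "Z_periodic v" "L-lipschitz_on UNIV v" "viscosity_supersolution (\<lambda>y r q. G y q - d) v"
  shows "d \<le> c"
proof -
  let ?Q = "cbox 0 (vec 1 :: real ^ 'n)"
  have v_cont: "continuous_on UNIV v" using v(2) by (rule lipschitz_on_continuous_on)
  have L: "L \<ge> 0" using v(2) by (rule lipschitz_on_nonneg)
  have v_lip: "\<bar>v x - v y\<bar> \<le> L * norm (x - y)" for x y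
    using lipschitz_onD[OF v(2), of x y] by (simp add: dist_norm)
  have key: "\<exists>y w. y \<in> ?Q \<and> norm w \<le> L / N \<and> G y ((2 * N) *\<^sub>R w) \<le> c \<and> d \<le> G (y - w) ((2 * N) *\<^sub>R w)"
    if N: "N \<ge> 1" for N
  proof -
    \<comment> \<open>The second point is written \<open>y - w\<close>, so that integer translations
      act on \<open>y\<close> alone and the maximum can be sought on a cube times a ball.\<close>
    define \<Phi> where "\<Phi> y w = u y - v (y - w) - N * (norm w)\<^sup>2" for y w
    have "continuous_on A (\<lambda>p. u (fst p))" "continuous_on A (\<lambda>p. v (fst p - snd p))" for A
      by (rule continuous_on_compose2[OF u(2)] continuous_on_compose2[OF v_cont];
        auto intro!: continuous_intros)+
    then have "continuous_on (?Q \<times> cball 0 L) (\<lambda>p. \<Phi> (fst p) (snd p))"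
      unfolding \<Phi>_def by (intro continuous_intros)
    then have "\<exists>p\<in>?Q \<times> cball 0 L. \<forall>p'\<in>?Q \<times> cball 0 L. \<Phi> (fst p') (snd p') \<le> \<Phi> (fst p) (snd p)"
      using L unit_cube_nonempty
      by (intro continuous_attains_sup compact_Times unit_cube_compact compact_cball) auto
    then obtain y w where yw: "y \<in> ?Q" "norm w \<le> L"
      "\<And>y' w'. y' \<in> ?Q \<Longrightarrow> norm w' \<le> L \<Longrightarrow> \<Phi> y' w' \<le> \<Phi> y w"
      by (auto simp: Ball_def)
    have \<Phi>_per: "\<Phi> (y' + k) w' = \<Phi> y' w'" if k: "\<forall>i. k $ i \<in> \<int>" for y' w' k
    proof -
      have "v (y' + k - w') = v ((y' - w') + k)" by (simp add: algebra_simps)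
      then show ?thesis using Z_periodicD[OF u(1) k] Z_periodicD[OF v(1) k] by (simp add: \<Phi>_def)
    qed
    have max': "\<Phi> y' w' \<le> \<Phi> y w" if w': "norm w' \<le> L" for y' w'
    proof -
      obtain z k where "z \<in> ?Q" "\<forall>i. k $ i \<in> \<int>" "y' = z + k"
        by (rule integer_translate_in_unit_cube)
      then show ?thesis using yw(3)[of z w'] w' \<Phi>_per by simp
    qed
    \<comment> \<open>For \<open>norm w' > L\<close> and \<open>N \<ge> 1\<close> the penalty
      outweighs the possible gain \<open>L * norm w'\<close>, so \<open>w' = 0\<close> does at least
      as well.\<close>
    have max: "\<Phi> y' w' \<le> \<Phi> y w" for y' w'
    proof (cases "norm w' \<le> L")
      case False
      then have "L * norm w' \<le> norm w' * norm w'" by (intro mult_right_mono) auto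
      also have "\<dots> \<le> N * (norm w')\<^sup>2"
        using mult_right_mono[OF N, of "(norm w')\<^sup>2"] by (simp add: power2_eq_square)
      finally have "\<Phi> y' w' \<le> \<Phi> y' 0"
        using v_lip[of y' "y' - w'"] by (simp add: \<Phi>_def abs_le_iff)
      also have "\<dots> \<le> \<Phi> y w" using L by (intro max') simp
      finally show ?thesis .
    qed (rule max')
    have "\<Phi> y 0 \<le> \<Phi> y w" by (rule max)
    then have "(N * norm w) * norm w \<le> L * norm w"
      using v_lip[of y "y - w"] by (simp add: \<Phi>_def abs_le_iff power2_eq_square mult.assoc)
    then have "N * norm w \<le> L"
      using L by (cases "w = 0") auto
    then have "norm w \<le> L / N" using N by (simp add: field_simps)
    \<comment> \<open>The point \<open>y - w\<close> is frozen and the argument of \<open>u\<close>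
      varies.\<close>
    moreover have "G y ((2 * N) *\<^sub>R w) - c \<le> 0"
    proof -
      have "G y (N *\<^sub>R (2 *\<^sub>R (y - (y - w)))) - c \<le> 0"
      proof (rule viscosity_subsolutionD[OF u(3), where \<phi> = "\<lambda>x. N * (norm (x - (y - w)))\<^sup>2"
            and G = "\<lambda>x. N *\<^sub>R (2 *\<^sub>R (x - (y - w)))"])
        show "GDERIV (\<lambda>x. N * (norm (x - (y - w)))\<^sup>2) x :> N *\<^sub>R (2 *\<^sub>R (x - (y - w)))" for x
          by (intro GDERIV_const_mult GDERIV_norm_power2)
        show "continuous_on UNIV (\<lambda>x. N *\<^sub>R (2 *\<^sub>R (x - (y - w))))" by (intro continuous_intros)
        have "u x - N * (norm (x - (y - w)))\<^sup>2 \<le> u y - N * (norm (y - (y - w)))\<^sup>2" for x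
          using max[of x "x - (y - w)"] by (simp add: \<Phi>_def)
        then show "eventually (\<lambda>x. u x - N * (norm (x - (y - w)))\<^sup>2 \<le>
            u y - N * (norm (y - (y - w)))\<^sup>2) (nhds y)"
          by simp
      qed
      then show ?thesis by (simp add: mult.commute)
    qed
    \<comment> \<open>Now \<open>y\<close> is frozen and the argument of \<open>v\<close> varies;
      the negative quadratic has the same gradient \<open>2 N w\<close> at
      \<open>y - w\<close>.\<close>
    moreover have "0 \<le> G (y - w) ((2 * N) *\<^sub>R w) - d"
    proof -
      have "0 \<le> G (y - w) ((- N) *\<^sub>R (2 *\<^sub>R ((y - w) - y))) - d"
      proof (rule viscosity_supersolutionD[OF v(3), where \<phi> = "\<lambda>x. (- N) * (norm (x - y))\<^sup>2"
            and G = "\<lambda>x. (- N) *\<^sub>R (2 *\<^sub>R (x - y))"])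
        show "GDERIV (\<lambda>x. (- N) * (norm (x - y))\<^sup>2) x :> (- N) *\<^sub>R (2 *\<^sub>R (x - y))" for x
          by (intro GDERIV_const_mult GDERIV_norm_power2)
        show "continuous_on UNIV (\<lambda>x. (- N) *\<^sub>R (2 *\<^sub>R (x - y)))" by (intro continuous_intros)
        have "v (y - w) - (- N) * (norm ((y - w) - y))\<^sup>2 \<le> v x - (- N) * (norm (x - y))\<^sup>2" for x
          using max[of y "y - x"] by (simp add: \<Phi>_def norm_minus_commute)
        then show "eventually (\<lambda>x. v (y - w) - (- N) * (norm ((y - w) - y))\<^sup>2 \<le>
            v x - (- N) * (norm (x - y))\<^sup>2) (nhds (y - w))"
          by simp
      qed
      then show ?thesis by (simp add: mult.commute)
    qed
    ultimately show ?thesis using yw(1) by auto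
  qed
  have "\<exists>y w. y \<in> ?Q \<and> norm w \<le> L / real (Suc n) \<and> G y ((2 * real (Suc n)) *\<^sub>R w) \<le> c \<and>
      d \<le> G (y - w) ((2 * real (Suc n)) *\<^sub>R w)" for n
    by (rule key) simp
  then obtain y w where yw: "\<And>n. y n \<in> ?Q" "\<And>n. norm (w n) \<le> L / real (Suc n)"
    "\<And>n. G (y n) ((2 * real (Suc n)) *\<^sub>R w n) \<le> c"
    "\<And>n. d \<le> G (y n - w n) ((2 * real (Suc n)) *\<^sub>R w n)"
    by metis
  \<comment> \<open>These common gradients lie in a fixed ball while \<open>w n\<close> tends to
    \<open>0\<close>, so along a subsequence both inequalities concern the same limit of
    \<open>G\<close>.\<close>
  define q where "q n = (2 * real (Suc n)) *\<^sub>R w n" for n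
  have q: "q n \<in> cball 0 (2 * L)" for n
  proof -
    have "real (Suc n) * norm (w n) \<le> L"
      using yw(2)[of n] by (simp add: pos_le_divide_eq mult.commute del: of_nat_Suc)
    then show ?thesis by (simp add: q_def del: of_nat_Suc)
  qed
  have "seq_compact (?Q \<times> cball (0 :: real ^ 'n) (2 * L))"
    by (intro compact_imp_seq_compact compact_Times unit_cube_compact compact_cball)
  moreover have "\<forall>n. (y n, q n) \<in> ?Q \<times> cball 0 (2 * L)" using yw(1) q by simp
  ultimately obtain l r where "l \<in> ?Q \<times> cball 0 (2 * L)"
    and lr: "strict_mono r" "((\<lambda>n. (y n, q n)) \<circ> r) \<longlonglongrightarrow> l"
    by (rule seq_compactE)
  have y_lim: "(\<lambda>n. y (r n)) \<longlonglongrightarrow> fst l" and q_lim: "(\<lambda>n. q (r n)) \<longlonglongrightarrow> snd l"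
    using tendsto_fst[OF lr(2)] tendsto_snd[OF lr(2)] by (simp_all add: o_def)
  have "(\<lambda>n. L * inverse (real (Suc n))) \<longlonglongrightarrow> L * 0"
    by (intro tendsto_intros LIMSEQ_inverse_real_of_nat)
  then have "w \<longlonglongrightarrow> 0"
    by (intro Lim_null_comparison[of w "\<lambda>n. L * inverse (real (Suc n))"] always_eventually)
      (use yw(2) in \<open>auto simp: divide_inverse\<close>)
  from LIMSEQ_subseq_LIMSEQ[OF this lr(1)] have w_lim: "(\<lambda>n. w (r n)) \<longlonglongrightarrow> 0"
    by (simp add: o_def)
  have G_lim: "(\<lambda>n. G (f n) (g n)) \<longlonglongrightarrow> G x p" if "f \<longlonglongrightarrow> x" "g \<longlonglongrightarrow> p" for f g x p
    using continuous_on_tendsto_compose[OF G_cont tendsto_Pair[OF that]] by simp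
  have "G (fst l) (snd l) \<le> c"
    by (rule LIMSEQ_le_const2[OF G_lim[OF y_lim q_lim]]) (use yw(3) in \<open>auto simp: q_def\<close>)
  moreover have "(\<lambda>n. G (y (r n) - w (r n)) (q (r n))) \<longlonglongrightarrow> G (fst l - 0) (snd l)"
    by (intro G_lim tendsto_intros y_lim w_lim q_lim)
  then have "d \<le> G (fst l - 0) (snd l)"
    by (rule LIMSEQ_le_const) (use yw(4) in \<open>auto simp: q_def\<close>)
  ultimately show ?thesis by simp
qed

section \<open>Existence by vanishing discount\<close>

lemma cell_problem_exists:
  fixes G :: "real ^ 'n \<Rightarrow> real ^ 'n \<Rightarrow> real"
  assumes G_cont: "continuous_on UNIV (\<lambda>(y, q). G y q)"
    and per: "\<And>q. Z_periodic (\<lambda>y. G y q)"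
    and coercive: "\<And>K. \<exists>R. \<forall>y q. G y q \<le> K \<longrightarrow> norm q \<le> R"
  shows "\<exists>c \<psi>. Z_periodic \<psi> \<and> (\<exists>L. L-lipschitz_on UNIV \<psi>) \<and>
    viscosity_solution (\<lambda>y r q. G y q - c) \<psi>"
proof -
  let ?Q = "cbox 0 (vec 1 :: real ^ 'n)"
  have "continuous_on UNIV (\<lambda>y. G y 0)"
    using continuous_on_compose2[OF G_cont, of UNIV "\<lambda>y. (y, 0)"] by (simp add: continuous_on_Pair)
  then have "compact ((\<lambda>y. G y 0) ` ?Q)"
    by (rule compact_continuous_image[OF continuous_on_subset[OF _ subset_UNIV] unit_cube_compact])
  then have "bounded ((\<lambda>y. G y 0) ` ?Q)" by (rule compact_imp_bounded)
  then obtain M where M_cube: "\<And>y. y \<in> ?Q \<Longrightarrow> \<bar>G y 0\<bar> \<le> M"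
    unfolding bounded_real by blast
  have M: "\<bar>G y 0\<bar> \<le> M" for y
  proof -
    obtain z k where "z \<in> ?Q" "\<forall>i. k $ i \<in> \<int>" "y = z + k"
      by (rule integer_translate_in_unit_cube)
    then show ?thesis using Z_periodicD[OF per] M_cube by simp
  qed
  obtain R0 where R0: "\<And>y q. G y q \<le> M \<Longrightarrow> norm q \<le> R0" using coercive by blast
  define R where "R = max 0 R0"
  define \<delta> where "\<delta> n = inverse (real (Suc n))" for n
  have loc: "coercive_hamiltonian G M R (\<delta> n)" for n
    by unfold_locales (use M R0 G_cont in \<open>auto simp: R_def \<delta>_def max.coboundedI2\<close>)
  note perron = coercive_hamiltonian.u_bound[OF loc] coercive_hamiltonian.u_lipschitz[OF loc]
    coercive_hamiltonian.u_subsolution[OF loc] coercive_hamiltonian.u_supersolution[OF loc]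
    coercive_hamiltonian.u_translate[OF loc]
  define U where "U n = perron_solution (\<delta> n) M G" for n
  \<comment> \<open>\<open>U n\<close> is only bounded by \<open>M / \<delta> n\<close>, which grows
    with \<open>n\<close>; subtracting \<open>U n 0\<close> leaves an equi-Lipschitz family
    vanishing at \<open>0\<close>, hence bounded on the cube.\<close>
  define v where "v n y = U n y - U n 0" for n y
  have \<delta>_pos: "\<delta> n > 0" for n by (simp add: \<delta>_def)
  have v_lip: "(R + 1)-lipschitz_on UNIV (v n)" for n
    using perron(2)[of n] by (simp add: lipschitz_on_def v_def U_def dist_real_def)
  have v_le: "\<bar>v n x - v n y\<bar> \<le> (R + 1) * norm (x - y)" for n x y
    using lipschitz_onD[OF v_lip, of x y n] by (simp add: dist_norm)
  have v_per: "v n (y + k) = v n y" if k: "\<forall>i. k $ i \<in> \<int>" for n y k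
  proof -
    have "\<forall>i. (- k) $ i \<in> \<int>" using k by simp
    then have "U n (y + k) = U n y"
      unfolding U_def using Z_periodicD[OF per k] Z_periodicD[OF per, of "- k"] by (intro perron(5)) auto
    then show ?thesis by (simp add: v_def)
  qed
  have "\<bar>\<delta> n * U n 0\<bar> \<le> M" for n
    using perron(1)[of n 0] \<delta>_pos[of n] by (simp add: U_def abs_mult field_simps)
  then have "\<forall>n. - \<delta> n * U n 0 \<in> {-M..M}" by (simp add: abs_le_iff minus_le_iff)
  with compact_imp_seq_compact[OF compact_Icc[of "-M" M]] obtain c r
    where "c \<in> {-M..M}" and r: "strict_mono r" "((\<lambda>n. - \<delta> n * U n 0) \<circ> r) \<longlonglongrightarrow> c"
    by (rule seq_compactE)
  obtain B where B: "\<And>y. y \<in> ?Q \<Longrightarrow> norm y \<le> B"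
    using compact_imp_bounded[OF unit_cube_compact] unfolding bounded_iff by blast
  have bound: "norm (v (r n) y) \<le> (R + 1) * B" if "y \<in> ?Q" for n y
  proof -
    have "\<bar>v (r n) y - v (r n) 0\<bar> \<le> (R + 1) * norm (y - 0)" by (rule v_le)
    also have "\<dots> \<le> (R + 1) * B" using B[OF that] by (intro mult_left_mono) (auto simp: R_def)
    finally show ?thesis by (simp add: v_def)
  qed
  have equi: "\<exists>d. 0 < d \<and> (\<forall>n y. y \<in> ?Q \<and> norm (x - y) < d \<longrightarrow> norm (v (r n) x - v (r n) y) < e)"
    if e: "e > 0" for x e
  proof (intro exI conjI allI impI)
    have R1: "R + 1 > 0" by (simp add: R_def)
    then show "0 < e / (R + 1)" using e by simp
    fix n y assume "y \<in> ?Q \<and> norm (x - y) < e / (R + 1)"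
    then have "(R + 1) * norm (x - y) < e" using R1 by (simp add: field_simps)
    then show "norm (v (r n) x - v (r n) y) < e" using v_le[of "r n" x y] by simp
  qed
  obtain g k where "continuous_on ?Q g" and k: "strict_mono (k :: nat \<Rightarrow> nat)"
    and g: "\<And>e. 0 < e \<Longrightarrow> \<exists>N. \<forall>n x. n \<ge> N \<and> x \<in> ?Q \<longrightarrow> norm (v (r (k n)) x - g x) < e"
    by (rule Arzela_Ascoli[OF unit_cube_compact, of "\<lambda>n. v (r n)", OF bound equi])
      (assumption | rule that)+
  define s where "s = r \<circ> k"
  have s: "strict_mono s" unfolding s_def using r(1) k by (rule strict_mono_o)
  \<comment> \<open>The representative in the cube is chosen independently of \<open>n\<close>, so
    uniform convergence on the cube becomes uniform convergence on the whole space.\<close>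
  have "\<exists>z. z \<in> ?Q \<and> (\<forall>n. v n y = v n z)" for y
    using integer_translate_in_unit_cube[of y] v_per by metis
  then obtain rep where rep: "\<And>y. rep y \<in> ?Q" "\<And>n y. v n y = v n (rep y)" by metis
  define \<psi> where "\<psi> y = g (rep y)" for y
  have lim: "uniform_limit UNIV (\<lambda>n. v (s n)) \<psi> sequentially"
  proof (rule uniform_limitI)
    fix e :: real assume "e > 0"
    from g[OF this] obtain N where "\<And>n x. n \<ge> N \<Longrightarrow> x \<in> ?Q \<Longrightarrow> norm (v (r (k n)) x - g x) < e"
      by blast
    then have "\<forall>y\<in>UNIV. dist (v (s n) y) (\<psi> y) < e" if "n \<ge> N" for n
      using rep(1) that by (subst rep(2)) (simp add: \<psi>_def s_def dist_norm)
    then show "eventually (\<lambda>n. \<forall>y\<in>UNIV. dist (v (s n) y) (\<psi> y) < e) sequentially"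
      unfolding eventually_sequentially by blast
  qed
  have ptlim: "(\<lambda>n. v (s n) y) \<longlonglongrightarrow> \<psi> y" for y
    using lim by (rule tendsto_uniform_limitI) simp
  \<comment> \<open>Periodicity is inherited from the \<open>v n\<close> in the limit, whatever the
    choice of \<open>rep\<close>.\<close>
  have "Z_periodic \<psi>"
    unfolding Z_periodic_def
  proof (intro allI impI)
    fix y k :: "real ^ 'n" assume "\<forall>i. k $ i \<in> \<int>"
    then have "(\<lambda>n. v (s n) (y + k)) \<longlonglongrightarrow> \<psi> y" using ptlim[of y] v_per by simp
    then show "\<psi> (y + k) = \<psi> y" using ptlim by (rule LIMSEQ_unique[rotated])
  qed
  moreover have "(R + 1)-lipschitz_on UNIV \<psi>"
  proof (rule lipschitz_onI)
    fix x y
    show "dist (\<psi> x) (\<psi> y) \<le> (R + 1) * dist x y"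
      by (rule LIMSEQ_le_const2[OF tendsto_dist[OF ptlim ptlim]])
        (use lipschitz_onD[OF v_lip] in auto)
  qed (simp add: R_def)
  moreover have "viscosity_solution (\<lambda>y r q. G y q - c) \<psi>"
  proof -
    \<comment> \<open>This is the equation for the normalised functions: the discount of
      \<open>v\<close> vanishes in the limit, while \<open>\<delta> (s n) * U (s n) 0\<close> tends
      to \<open>- c\<close>.\<close>
    let ?F = "\<lambda>n y r q. \<delta> (s n) * (r + U (s n) 0) + G y q"
    have v_cont: "continuous_on UNIV (v (s n))" for n
      using v_lip by (rule lipschitz_on_continuous_on)
    have sub: "viscosity_subsolution (?F n) (v (s n))" for n
      using viscosity_subsolution_shift_value[OF perron(3)[of "s n"], of "U (s n) 0"]
      by (simp add: v_def[abs_def] U_def)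
    have super: "viscosity_supersolution (?F n) (v (s n))" for n
      using viscosity_supersolution_shift_value[OF perron(4)[of "s n"], of "U (s n) 0"]
      by (simp add: v_def[abs_def] U_def)
    have \<delta>_lim: "(\<lambda>n. \<delta> (s n)) \<longlonglongrightarrow> 0"
      using LIMSEQ_subseq_LIMSEQ[OF LIMSEQ_inverse_real_of_nat s] by (simp add: \<delta>_def[abs_def] o_def)
    have c_lim: "(\<lambda>n. - \<delta> (s n) * U (s n) 0) \<longlonglongrightarrow> c"
      using LIMSEQ_subseq_LIMSEQ[OF r(2) k] by (simp add: s_def o_def)
    have F_lim: "(\<lambda>n. ?F n (z n) (t n) (q n)) \<longlonglongrightarrow> G y p - c"
      if "z \<longlonglongrightarrow> y" "t \<longlonglongrightarrow> t'" "q \<longlonglongrightarrow> p" for z t q y and t' :: real and p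
    proof -
      have "(\<lambda>n. \<delta> (s n) * t n - (- \<delta> (s n) * U (s n) 0) + G (z n) (q n)) \<longlonglongrightarrow> 0 * t' - c + G y p"
        by (intro tendsto_intros \<delta>_lim c_lim that coercive_hamiltonian.G_tendsto[OF loc])
      then show ?thesis by (simp add: algebra_simps)
    qed
    show ?thesis
      unfolding viscosity_solution_def
      using viscosity_subsolution_uniform_limit[OF v_cont sub lim, of "\<lambda>y r q. G y q - c"]
        viscosity_supersolution_uniform_limit[OF v_cont super lim, of "\<lambda>y r q. G y q - c"]
        F_lim by blast
  qed
  ultimately show ?thesis by blast
qed

theorem cell_problem_unique_constant:
  fixes G :: "real ^ 'n \<Rightarrow> real ^ 'n \<Rightarrow> real"
  assumes G_cont: "continuous_on UNIV (\<lambda>(y, q). G y q)"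
    and per: "\<And>q. Z_periodic (\<lambda>y. G y q)"
    and coercive: "\<And>K. \<exists>R. \<forall>y q. G y q \<le> K \<longrightarrow> norm q \<le> R"
  shows "\<exists>!c. \<exists>\<psi>. Z_periodic \<psi> \<and> (\<exists>L. L-lipschitz_on UNIV \<psi>) \<and>
    viscosity_solution (\<lambda>y r q. G y q - c) \<psi>"
proof -
  have le: "d \<le> c"
    if "Z_periodic u" "L-lipschitz_on UNIV u" "viscosity_solution (\<lambda>y r q. G y q - c) u"
      "Z_periodic v" "L'-lipschitz_on UNIV v" "viscosity_solution (\<lambda>y r q. G y q - d) v"
    for c d u v L L'
    using that viscosity_comparison_of_constants[OF G_cont, of u c v L' d]
    by (auto simp: viscosity_solution_def lipschitz_on_continuous_on)
  show ?thesis
  proof (rule ex_ex1I)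
    show "\<exists>c \<psi>. Z_periodic \<psi> \<and> (\<exists>L. L-lipschitz_on UNIV \<psi>) \<and>
        viscosity_solution (\<lambda>y r q. G y q - c) \<psi>"
      by (rule cell_problem_exists[OF assms])
  qed (blast intro: le antisym)
qed

section \<open>Coercivity from the superlinear growth condition\<close>

text \<open>
  Along each ray \<open>t \<mapsto> h i (t e)\<close>, the hypothesis bounds the growth of \<open>h i (t e) / t\<close> from below.
  Going from \<open>1\<close> to a fixed large \<open>t\<close> costs at most a constant; going on from \<open>t\<close> to any
  \<open>s \<ge> 2 t\<close> gains more than that.
\<close>

lemma superlinear_imp_norm_le:
  fixes h :: "'b \<Rightarrow> 'a::real_normed_vector \<Rightarrow> real"
  assumes b0: "b0 > 0" and C0: "C0 > 0" and m: "m > 1"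
    and super: "\<And>\<mu> i p. 0 < \<mu> \<Longrightarrow> \<mu> < 1 \<Longrightarrow>
      \<mu> * h i (inverse \<mu> *\<^sub>R p) - h i p \<ge> (1 - \<mu>) * (b0 * norm p powr m - C0)"
    and B: "\<And>i p. norm p \<le> 1 \<Longrightarrow> \<bar>h i p\<bar> \<le> B"
  shows "\<exists>\<rho>. \<forall>i p. \<rho> \<le> norm p \<longrightarrow> norm p \<le> h i p"
proof -
  \<comment> \<open>\<open>undefined\<close> stands for an arbitrary index; any element of the type
    serves.\<close>
  have B0: "B \<ge> 0" using B[of 0 undefined] by simp
  \<comment> \<open>This is the growth hypothesis with \<open>\<mu> = t / s\<close> at the point
    \<open>t e\<close>, for which \<open>inverse \<mu>\<close> times the point is
    \<open>s e\<close>.\<close>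
  have ray: "(t / s) * h i (s *\<^sub>R e) - h i (t *\<^sub>R e) \<ge> (1 - t / s) * (b0 * t powr m - C0)"
    if "0 < t" "t < s" "norm e = 1" for t s i e
  proof -
    have "inverse (t / s) *\<^sub>R t *\<^sub>R e = s *\<^sub>R e" "norm (t *\<^sub>R e) = t" using that by auto
    moreover have "0 < t / s" "t / s < 1" using that by auto
    ultimately show ?thesis using super[where \<mu> = "t / s" and i = i and p = "t *\<^sub>R e"]
      by (simp only:)
  qed
  \<comment> \<open>\<open>t\<close> is chosen to satisfy
    \<open>A \<le> b0 * t powr (m - 1)\<close>. Together with \<open>C0 \<le> C0 * t\<close> this
    yields \<open>big\<close>, whose factor \<open>2\<close> absorbs the loss from
    \<open>1 - t / s \<ge> 1 / 2\<close>.\<close>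
  define A where "A = 2 * (B + C0 + 1) + C0"
  define t where "t = max 2 ((A / b0) powr (1 / (m - 1)))"
  have t: "t \<ge> 2" by (simp add: t_def)
  have A: "A > 0" using B0 C0 by (simp add: A_def)
  have "A / b0 = ((A / b0) powr (1 / (m - 1))) powr (m - 1)"
    using A b0 m by (simp add: powr_powr)
  also have "\<dots> \<le> t powr (m - 1)"
    using m by (intro powr_mono2) (auto simp: t_def)
  finally have "A \<le> b0 * t powr (m - 1)" using b0 by (simp add: field_simps)
  then have "A * t \<le> b0 * t powr (m - 1) * t" using t by (intro mult_right_mono) auto
  also have "\<dots> = b0 * t powr m"
    using t powr_add[of t "m - 1" 1] by simp
  finally have "A * t \<le> b0 * t powr m" .
  moreover have "C0 \<le> C0 * t" using t C0 by simp
  ultimately have big: "2 * (t * (B + C0 + 1)) \<le> b0 * t powr m - C0"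
    by (simp add: A_def algebra_simps)
  have "norm p \<le> h i p" if p: "2 * t \<le> norm p" for i p
  proof -
    define e where "e = inverse (norm p) *\<^sub>R p"
    define s where "s = norm p"
    have s: "2 * t \<le> s" "s > 0" using p t by (auto simp: s_def)
    have e: "norm e = 1" "p = s *\<^sub>R e" using s by (auto simp: e_def s_def)
    have "(1 / t) * h i (t *\<^sub>R e) - h i (1 *\<^sub>R e) \<ge> (1 - 1 / t) * (b0 * 1 powr m - C0)"
      using t e by (intro ray) auto
    moreover have "(1 - 1 / t) * (b0 * 1 powr m - C0) \<ge> - C0"
    proof -
      have "(1 - 1 / t) * C0 \<le> 1 * C0" using t C0 by (intro mult_right_mono) auto
      moreover have "(1 - 1 / t) * b0 \<ge> 0" using t b0 by (intro mult_nonneg_nonneg) auto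
      ultimately show ?thesis by (simp add: right_diff_distrib)
    qed
    moreover have "h i (1 *\<^sub>R e) \<ge> - B" using B[of "1 *\<^sub>R e" i] e by (simp add: abs_le_iff)
    ultimately have "- (B + C0) \<le> h i (t *\<^sub>R e) / t" by simp
    then have "- (B + C0) * t \<le> h i (t *\<^sub>R e)" using t by (simp add: field_simps)
    moreover have "(t / s) * h i (s *\<^sub>R e) - h i (t *\<^sub>R e) \<ge> (1 - t / s) * (b0 * t powr m - C0)"
      using t s e by (intro ray) auto
    \<comment> \<open>The gain is at least \<open>t * (B + C0 + 1)\<close>. The value at
      \<open>t e\<close> may cost \<open>t * (B + C0)\<close>, which leaves
      \<open>t\<close>.\<close>
    moreover have "(1 - t / s) * (b0 * t powr m - C0) \<ge> (1 / 2) * (2 * (t * (B + C0 + 1)))"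
      using s t B0 C0 by (intro mult_mono big) (auto simp: field_simps)
    ultimately have "t \<le> (t / s) * h i (s *\<^sub>R e)" by (simp add: algebra_simps)
    then have "t * s \<le> t * h i p" using s by (simp add: e(2) field_simps)
    then show ?thesis using t by (simp add: s_def)
  qed
  then show ?thesis by blast
qed

section \<open>Application with \<open>x\<close>, \<open>p\<close> and \<open>l\<close>
  fixed\<close>

theorem proposition6p1:
  fixes a :: "real ^ 'n \<Rightarrow> real ^ 'n \<Rightarrow> real"
    and H :: "real ^ 'n \<Rightarrow> real ^ 'n \<Rightarrow> real ^ 'n \<Rightarrow> real"
    and a0 b0 C0 m :: real
    and \<omega> :: "real \<Rightarrow> real"
  assumes a_unif_cont: "uniformly_continuous_on UNIV (\<lambda>(x, y). a x y)"
    and H_cont: "continuous_on UNIV (\<lambda>(x, y, p). H x y p)"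
    and a0_pos: "a0 > 0"
    and a_bounds: "\<And>x y. a0 \<le> a x y \<and> a x y \<le> inverse a0"
    and H0_bounded: "bounded (range (\<lambda>(x, y). H x y 0))"
    and a_bounded: "bounded (range (\<lambda>(x, y). a x y))"
    and a_periodic: "\<And>x. Z_periodic (a x)"
    and H_periodic: "\<And>x p. Z_periodic (\<lambda>y. H x y p)"
    and b0_pos: "b0 > 0" and C0_pos: "C0 > 0" and m_gt_1: "m > 1"
    and H_superlinear: "\<And>\<mu> x y p. 0 < \<mu> \<Longrightarrow> \<mu> < 1 \<Longrightarrow>
      \<mu> * H x y (inverse \<mu> *\<^sub>R p) - H x y p \<ge> (1 - \<mu>) * (b0 * norm p powr m - C0)"
    and modulus: "modulus_of_continuity \<omega>"
    and H_regular: "\<And>R x x' y y' p p'. R > 0 \<Longrightarrow> norm p \<le> R \<Longrightarrow> norm p' \<le> R \<Longrightarrow>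
      \<bar>H x y p - H x' y' p'\<bar> \<le>
        \<omega> (norm (x - x') + norm (y - y')) * (1 + R powr m)
        + \<omega> (norm (p - p')) * (1 + R powr (m - 1))"
  shows "\<forall>x p. \<forall>l::real. \<exists>!c. \<exists>\<psi>. Z_periodic \<psi> \<and> (\<exists>L. L-lipschitz_on UNIV \<psi>) \<and>
      viscosity_solution (\<lambda>y r q. - a x y * l + H x y (p + q) - c) \<psi>"
proof (intro allI)
  fix x p :: "real ^ 'n" and l :: real
  have \<omega>: "mono_on {0..} \<omega>" "\<omega> 0 = 0"
    using modulus by (auto simp: modulus_of_continuity_def)
  obtain B0 where B0: "\<And>y. \<bar>H x y 0\<bar> \<le> B0"
    using H0_bounded unfolding bounded_iff by fastforce
  \<comment> \<open>Comparison with \<open>q = 0\<close> at the same \<open>x\<close> and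
    \<open>y\<close>, on the ball of radius \<open>1\<close>: the space term is
    \<open>\<omega> 0 = 0\<close> and the remaining weight is \<open>1 + 1 = 2\<close>.\<close>
  have B: "\<bar>H x y q\<bar> \<le> B0 + 2 * \<omega> 1" if "norm q \<le> 1" for y q
  proof -
    have "\<bar>H x y q - H x y 0\<bar> \<le> 2 * \<omega> (norm q)"
      using H_regular[of 1 q 0 x y x y] that \<omega>(2) by simp
    also have "\<dots> \<le> 2 * \<omega> 1" using mono_onD[OF \<omega>(1), of "norm q" 1] that by simp
    finally show ?thesis using B0[of y] by linarith
  qed
  obtain \<rho> where \<rho>: "\<And>y q. \<rho> \<le> norm q \<Longrightarrow> norm q \<le> H x y q"
    using superlinear_imp_norm_le[of b0 C0 m "H x", OF b0_pos C0_pos m_gt_1 H_superlinear B] by blast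
  show "\<exists>!c. \<exists>\<psi>. Z_periodic \<psi> \<and> (\<exists>L. L-lipschitz_on UNIV \<psi>) \<and>
      viscosity_solution (\<lambda>y r q. - a x y * l + H x y (p + q) - c) \<psi>"
  proof (rule cell_problem_unique_constant)
    have "continuous_on UNIV (\<lambda>z :: (real ^ 'n) \<times> (real ^ 'n). a x (fst z))"
      using continuous_on_compose2[OF uniformly_continuous_imp_continuous[OF a_unif_cont],
          of UNIV "\<lambda>z :: (real ^ 'n) \<times> (real ^ 'n). (x, fst z)"]
      by (simp add: continuous_on_Pair continuous_on_fst continuous_on_id)
    moreover have "continuous_on UNIV (\<lambda>z. H x (fst z) (p + snd z))"
      using continuous_on_compose2[OF H_cont, of UNIV "\<lambda>z. (x, fst z, p + snd z)"]
      by (simp add: continuous_on_Pair continuous_on_fst continuous_on_snd continuous_on_add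
          continuous_on_id)
    ultimately show "continuous_on UNIV (\<lambda>(y, q). - a x y * l + H x y (p + q))"
      unfolding case_prod_beta by (intro continuous_intros)
  next
    show "Z_periodic (\<lambda>y. - a x y * l + H x y (p + q))" for q
      using a_periodic[of x] H_periodic[of x "p + q"] by (simp add: Z_periodic_def)
  next
    fix K
    \<comment> \<open>Either \<open>norm (p + q) < \<rho>\<close>, or
      \<open>norm (p + q) \<le> H x y (p + q) \<le> K + a x y * l\<close>; the upper bound on
      \<open>a\<close> makes this uniform in \<open>y\<close>.\<close>
    have "norm q \<le> max \<rho> (K + inverse a0 * \<bar>l\<bar>) + norm p"
      if le: "- a x y * l + H x y (p + q) \<le> K" for y q
    proof -
      have "a x y * l \<le> a x y * \<bar>l\<bar>"
        using a_bounds[of x y] a0_pos by (intro mult_left_mono) auto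
      also have "\<dots> \<le> inverse a0 * \<bar>l\<bar>" using a_bounds[of x y] by (intro mult_right_mono) auto
      finally have "norm (p + q) \<le> max \<rho> (K + inverse a0 * \<bar>l\<bar>)"
        using \<rho>[of "p + q" y] le by linarith
      then show ?thesis using norm_triangle_ineq4[of "p + q" p] by simp
    qed
    then show "\<exists>R. \<forall>y q. - a x y * l + H x y (p + q) \<le> K \<longrightarrow> norm q \<le> R" by blast
  qed
qed

end
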